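(* Let $X$ be a real $n\times m$ matrix whose columns (attributes) have been scaled to unit variance. Let $\mathcal{T}_{H_1}=\{([n],[m])\}$ and $\mathcal{T}_{H_2}=\bigcup_{j=1}^m\{([n],\{j\})\}$, let $\mathcal{H}=\langle\emptyset+\mathcal{T}_{H_1},\,\emptyset+\mathcal{T}_{H_2}\rangle$ (i.e. no background-knowledge tiles), and let $\Sigma_1$ and $\Sigma_2$ be the covariance matrices of the uniform distributions on $\Omega_{\mathcal{T}_{H_1}}$ and $\Omega_{\mathcal{T}_{H_2}}$, respectively. Then a solution of the optimisation problem $$\max_{v\in\mathbb{R}^m,\ v\neq0} G(v,\mathcal{H}),\qquad G(v,\mathcal{H})=\frac{v^T\Sigma_1v}{v^T\Sigma_2v},$$ is given by the first principal component of the correlation matrix of the data $X$.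
   Context: Write $[k]=\{1,\dots,k\}$. $\mathcal{P}_n$ is the set of bijections $[n]\to[n]$, and $\mathcal{P}_n^m$ is the set of vectors $\Pi=(\pi_1,\dots,\pi_m)$ with $\pi_j\in\mathcal{P}_n$. For an $n\times m$ matrix $X$, $\Pi(X)$ is the matrix $\widehat X$ with $\widehat X(i,j)=X(\pi_j(i),j)$. A tile is a pair $t=(R,C)$ with $R\subseteq[n]$, $C\subseteq[m]$. $\Pi$ is allowed by $t=(R,C)$ iff for all $i\in[n]$, $j,j'\in[m]$: $i\in R$ and $j,j'\in C$ imply $\pi_j(i)\in R$ and $\pi_j(i)=\pi_{j'}(i)$. $\Pi$ is allowed by a set of tiles iff it is allowed by each tile in it. For a set of tiles $T$, $\Omega_T=\{\Pi(X):\Pi\in\mathcal{P}_n^m,\ \Pi\text{ is allowed by }T\}$. The notation $\mathcal{T}+\mathcal{T}'$ denotes merging two sets of tiles into a set of pairwise non-overlapping tiles that allows the same vectors of permutations as $\mathcal{T}\cup\mathcal{T}'$; here $\emptyset+\mathcal{T}_{H_i}$ is just $\mathcal{T}_{H_i}$. Let $Y(i,l)=X(i,l)-\frac1n\sum_{k=1}^nX(k,l)$ be the column-centred data. Unit variance means $\frac1n\sum_{i=1}^nY(i,l)^2=1$ for each $l\in[m]$. The covariance matrix of the uniform distribution on $\Omega_T$ is the $m\times m$ matrix with entries $\Sigma(j,j')=E\left[\frac1n\sum_{i=1}^nY(\pi_j(i),j)Y(\pi_{j'}(i),j')\right]$, where $\Pi=(\pi_1,\dots,\pi_m)$ is uniformly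 distributed over the vectors in $\mathcal{P}_n^m$ allowed by $T$. The correlation matrix of $X$ is the $m\times m$ matrix of Pearson correlation coefficients of the columns of $X$. The first principal component of a symmetric positive semidefinite matrix is a unit eigenvector for its largest eigenvalue. *)

theory Defs
  imports "HOL-Analysis.Analysis" "HOL-Probability.Probability_Mass_Function"
begin

text \<open>
  An \<open>n \<times> m\<close> data matrix has type \<open>real ^ 'm ^ 'n\<close>: rows (data items) are indexed by
  \<open>'n\<close>, columns (attributes) by \<open>'m\<close>, so \<open>[n]\<close> and \<open>[m]\<close> are the universal sets of the index
  types, and \<open>X(i,j)\<close> is \<open>X $ i $ j\<close>.
\<close>

type_synonym ('n, 'm) tile = "'n set \<times> 'm set"

definition perm_vectors :: "('m \<Rightarrow> 'n \<Rightarrow> 'n) set" where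
  "perm_vectors = {\<pi>. \<forall>j. bij (\<pi> j)}"

definition permute_columns :: "('m \<Rightarrow> 'n \<Rightarrow> 'n) \<Rightarrow> real ^ 'm ^ 'n \<Rightarrow> real ^ 'm ^ 'n" where
  "permute_columns \<pi> X = (\<chi> i j. X $ \<pi> j i $ j)"

fun allowed_by_tile :: "('n, 'm) tile \<Rightarrow> ('m \<Rightarrow> 'n \<Rightarrow> 'n) \<Rightarrow> bool" where
  "allowed_by_tile (R, C) \<pi> \<longleftrightarrow>
     (\<forall>i j j'. i \<in> R \<and> j \<in> C \<and> j' \<in> C \<longrightarrow> \<pi> j i \<in> R \<and> \<pi> j i = \<pi> j' i)"

definition allowed_vectors :: "('n, 'm) tile set \<Rightarrow> ('m \<Rightarrow> 'n \<Rightarrow> 'n) set" where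
  "allowed_vectors T = {\<pi> \<in> perm_vectors. \<forall>t\<in>T. allowed_by_tile t \<pi>}"

definition centred :: "real ^ 'm ^ 'n \<Rightarrow> real ^ 'm ^ 'n" where
  "centred X = (\<chi> i l. X $ i $ l - (1 / real CARD('n)) * (\<Sum>k\<in>UNIV. X $ k $ l))"

definition unit_variance :: "real ^ 'm ^ 'n \<Rightarrow> bool" where
  "unit_variance X \<longleftrightarrow>
     (\<forall>l. (1 / real CARD('n)) * (\<Sum>i\<in>UNIV. (centred X $ i $ l)\<^sup>2) = 1)"

text \<open>
  The uniform distribution on the samples of \<open>X\<close> is the one induced by a uniformly distributed
  allowed vector of permutations: a matrix arising from several vectors is counted with
  multiplicity. The set of allowed vectors is finite and contains the vector of identities.
\<close>

definition covariance_matrix :: "real ^ 'm ^ 'n \<Rightarrow> ('n, 'm) tile set \<Rightarrow> real ^ 'm ^ 'm" where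
  "covariance_matrix X T =
     (\<chi> j j'. measure_pmf.expectation (pmf_of_set (allowed_vectors T))
        (\<lambda>\<pi>. (1 / real CARD('n)) *
           (\<Sum>i\<in>UNIV. permute_columns \<pi> (centred X) $ i $ j *
                        permute_columns \<pi> (centred X) $ i $ j')))"

definition correlation_matrix :: "real ^ 'm ^ 'n \<Rightarrow> real ^ 'm ^ 'm" where
  "correlation_matrix X =
     (\<chi> j j'. (\<Sum>i\<in>UNIV. centred X $ i $ j * centred X $ i $ j') /
        (sqrt (\<Sum>i\<in>UNIV. (centred X $ i $ j)\<^sup>2) * sqrt (\<Sum>i\<in>UNIV. (centred X $ i $ j')\<^sup>2)))"

definition tiles_H1 :: "('n, 'm) tile set" where
  "tiles_H1 = {(UNIV, UNIV)}"

definition tiles_H2 :: "('n, 'm) tile set" where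
  "tiles_H2 = (\<Union>j. {(UNIV, {j})})"

definition gain ::
  "real ^ 'm ^ 'n \<Rightarrow> real ^ 'm \<Rightarrow> ('n, 'm) tile set \<times> ('n, 'm) tile set \<Rightarrow> real" where
  "gain X v H = (v \<bullet> (covariance_matrix X (fst H) *v v)) / (v \<bullet> (covariance_matrix X (snd H) *v v))"

definition is_eigenvector :: "real ^ 'm ^ 'm \<Rightarrow> real ^ 'm \<Rightarrow> real \<Rightarrow> bool" where
  "is_eigenvector A v e \<longleftrightarrow> v \<noteq> 0 \<and> A *v v = e *\<^sub>R v"

definition is_eigenvalue :: "real ^ 'm ^ 'm \<Rightarrow> real \<Rightarrow> bool" where
  "is_eigenvalue A e \<longleftrightarrow> (\<exists>v. is_eigenvector A v e)"

text \<open>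
  A predicate rather than a function: the vector is determined only up to sign, and not even up
  to sign when the largest eigenvalue has multiplicity greater than one.
\<close>

definition first_principal_component :: "real ^ 'm ^ 'm \<Rightarrow> real ^ 'm \<Rightarrow> bool" where
  "first_principal_component A v \<longleftrightarrow>
     norm v = 1 \<and> (\<exists>e. is_eigenvector A v e \<and> (\<forall>e'. is_eigenvalue A e' \<longrightarrow> e' \<le> e))"

end

theory Submission
  imports Defs
begin

text \<open>
  Vectors allowed by \<open>tiles_H1\<close> apply one common permutation to all columns, which leaves the
  cross products of columns unchanged, so \<open>\<Sigma>\<^sub>1\<close> is the correlation matrix. Vectors allowed by
  \<open>tiles_H2\<close> permute the columns independently, so distinct centred columns become uncorrelated
  and \<open>\<Sigma>\<^sub>2\<close> is the identity matrix. The gain is therefore the Rayleigh quotient of the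
  correlation matrix.
\<close>

text \<open>Compactness of the unit sphere yields a maximiser \<open>v\<close> of the quadratic
  form; homogeneity of degree 2 extends the bound to all \<open>w\<close>, and optimality forces
  \<open>v\<close> to be an eigenvector.\<close>

lemma symmetric_matrix_max_eigenvalue:
  fixes A :: "real ^ 'm ^ 'm"
  assumes sym: "transpose A = A"
  obtains v e where "norm v = 1" "is_eigenvector A v e" "\<And>w. w \<bullet> (A *v w) \<le> e * (w \<bullet> w)"
proof -
  let ?S = "sphere (0 :: real ^ 'm) 1"
  have "continuous_on ?S (\<lambda>w. w \<bullet> (A *v w))"
    by (intro continuous_on_inner continuous_on_id matrix_vector_mult_linear_continuous_on)
  then have "\<exists>v\<in>?S. \<forall>w\<in>?S. w \<bullet> (A *v w) \<le> v \<bullet> (A *v v)"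
    by (intro continuous_attains_sup compact_sphere) simp_all
  then obtain v where v: "v \<in> ?S" "\<And>w. w \<in> ?S \<Longrightarrow> w \<bullet> (A *v w) \<le> v \<bullet> (A *v v)"
    by blast
  define e where "e = v \<bullet> (A *v v)"
  have norm_v: "norm v = 1"
    using v by simp
  have bound: "w \<bullet> (A *v w) \<le> e * (w \<bullet> w)" for w
  proof (cases "w = 0")
    case False
    let ?u = "(1 / norm w) *\<^sub>R w"
    have "?u \<bullet> (A *v ?u) \<le> e"
      using v(2)[of ?u] False unfolding e_def by simp
    then have "(w \<bullet> (A *v w)) / (norm w)\<^sup>2 \<le> e"
      by (simp add: matrix_vector_mult_scaleR power2_eq_square)
    then show ?thesis
      using False by (simp add: divide_le_eq power2_norm_eq_inner)
  qed simp
  \<comment> \<open>The nonnegative form \<open>e * (w \<bullet> w) - w \<bullet> (A *v w)\<close> vanishes at \<open>v\<close>; a nonzero residual \<open>b\<close>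
    would make it negative at a point \<open>v + t *\<^sub>R b\<close> with small \<open>t < 0\<close>.\<close>
  define b where "b = e *\<^sub>R v - A *v v"
  define p where "p = b \<bullet> b"
  define q where "q = e * p - b \<bullet> (A *v b)"
  have quadratic: "0 \<le> 2 * t * p + t\<^sup>2 * q" for t
  proof -
    \<comment> \<open>Symmetry of \<open>A\<close> merges the two cross terms;
      \<open>v \<bullet> v = 1\<close> cancels the constant term.\<close>
    have "v \<bullet> (A *v b) = b \<bullet> (A *v v)"
      by (metis dot_lmul_matrix inner_commute sym transpose_matrix_vector)
    moreover have "v \<bullet> v = 1"
      using norm_v by (simp add: norm_eq_1)
    ultimately have "e * ((v + t *\<^sub>R b) \<bullet> (v + t *\<^sub>R b))
        - (v + t *\<^sub>R b) \<bullet> (A *v (v + t *\<^sub>R b))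
        = 2 * t * (e * (v \<bullet> b) - b \<bullet> (A *v v)) + t\<^sup>2 * q"
      by (simp add: q_def p_def e_def matrix_vector_right_distrib matrix_vector_mult_scaleR
          inner_add_left inner_add_right inner_commute[of b v] power2_eq_square algebra_simps)
    moreover have "e * (v \<bullet> b) - b \<bullet> (A *v v) = p"
      unfolding p_def by (subst (3) b_def) (simp add: inner_diff_right inner_commute)
    ultimately show ?thesis
      using bound[of "v + t *\<^sub>R b"] by simp
  qed
  have "b = 0"
  proof (rule ccontr)
    assume "b \<noteq> 0"
    then have "p > 0"
      by (simp add: p_def)
    have "q \<ge> 0"
      using bound[of b] by (simp add: q_def p_def)
    \<comment> \<open>For \<open>q > 0\<close> the quadratic is minimal at \<open>- p / q\<close>;
      the denominator \<open>q + 1\<close> also covers \<open>q = 0\<close> and still gives a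
      negative value.\<close>
    let ?t = "- p / (q + 1)"
    have "2 * ?t * p + ?t\<^sup>2 * q = (p / (q + 1))\<^sup>2 * (q - 2 * (q + 1))"
      using \<open>q \<ge> 0\<close> by (simp add: power2_eq_square divide_simps) (simp add: algebra_simps)
    also have "\<dots> < 0"
      using \<open>p > 0\<close> \<open>q \<ge> 0\<close> by (intro mult_pos_neg) auto
    finally show False
      using quadratic[of ?t] by simp
  qed
  moreover have "v \<noteq> 0"
    using norm_v by auto
  ultimately have "is_eigenvector A v e"
    by (simp add: is_eigenvector_def b_def)
  then show thesis
    using that norm_v bound by blast
qed

lemma inner_eigenvector:
  assumes "is_eigenvector A v e"
  shows "v \<bullet> (A *v v) = e * (v \<bullet> v)"
  using assms by (simp add: is_eigenvector_def)

lemma first_principal_component_exists: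
  fixes A :: "real ^ 'm ^ 'm"
  assumes "transpose A = A"
  shows "\<exists>v. first_principal_component A v"
proof -
  obtain v e where v: "norm v = 1" "is_eigenvector A v e"
    and bound: "\<And>w. w \<bullet> (A *v w) \<le> e * (w \<bullet> w)"
    using symmetric_matrix_max_eigenvalue[OF assms] by blast
  have "e' \<le> e" if "is_eigenvector A u e'" for u e'
    using bound[of u] inner_eigenvector[OF that] that by (simp add: is_eigenvector_def)
  then show ?thesis
    using v unfolding first_principal_component_def is_eigenvalue_def by blast
qed

text \<open>The maximum \<open>e0\<close> of the form on the sphere is itself an eigenvalue, so the
  largest eigenvalue \<open>e\<close> dominates it and bounds every Rayleigh quotient;
  \<open>v\<close> attains \<open>e\<close>.\<close>

lemma first_principal_component_arg_max:
  fixes A :: "real ^ 'm ^ 'm"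
  assumes sym: "transpose A = A" and v: "first_principal_component A v"
  shows "is_arg_max (\<lambda>w. (w \<bullet> (A *v w)) / (w \<bullet> w)) (\<lambda>w. w \<noteq> 0) v"
proof -
  obtain e where e: "is_eigenvector A v e" "\<And>e'. is_eigenvalue A e' \<Longrightarrow> e' \<le> e"
    using v unfolding first_principal_component_def by blast
  obtain u e0 where u: "is_eigenvector A u e0" "\<And>w. w \<bullet> (A *v w) \<le> e0 * (w \<bullet> w)"
    using symmetric_matrix_max_eigenvalue[OF sym] by metis
  have "e0 \<le> e"
    using e(2) u(1) unfolding is_eigenvalue_def by blast
  have "v \<noteq> 0"
    using e(1) by (simp add: is_eigenvector_def)
  have le: "(w \<bullet> (A *v w)) / (w \<bullet> w) \<le> e" if "w \<noteq> 0" for w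
  proof -
    have "(w \<bullet> (A *v w)) / (w \<bullet> w) \<le> e0"
      using u(2)[of w] that by (simp add: divide_le_eq)
    then show ?thesis
      using \<open>e0 \<le> e\<close> by simp
  qed
  have v_quotient: "(v \<bullet> (A *v v)) / (v \<bullet> v) = e"
    using \<open>v \<noteq> 0\<close> inner_eigenvector[OF e(1)] by simp
  show ?thesis
    unfolding is_arg_max_def v_quotient using \<open>v \<noteq> 0\<close> le by (auto simp: not_less)
qed

text \<open>Together with nonemptiness, this turns the expectation under \<open>pmf_of_set\<close>
  into an arithmetic mean.\<close>

lemma finite_allowed_vectors:
  "finite (allowed_vectors T :: ('m::finite \<Rightarrow> 'n::finite \<Rightarrow> 'n) set)"
  by (rule finite_subset[OF subset_UNIV]) simp

lemma allowed_vectors_nonempty: "(allowed_vectors T :: ('m \<Rightarrow> 'n \<Rightarrow> 'n) set) \<noteq> {}"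
proof -
  have "allowed_by_tile t (\<lambda>_. id)" for t :: "('n, 'm) tile"
    by (cases t) auto
  then have "(\<lambda>_. id :: 'n \<Rightarrow> 'n) \<in> allowed_vectors (T :: ('n, 'm) tile set)"
    by (simp add: allowed_vectors_def perm_vectors_def)
  then show ?thesis
    by blast
qed

lemma bij_allowed_vectors: "\<pi> \<in> allowed_vectors T \<Longrightarrow> bij (\<pi> j)"
  by (simp add: allowed_vectors_def perm_vectors_def)

lemma allowed_vectors_H1: "\<pi> \<in> allowed_vectors tiles_H1 \<Longrightarrow> \<pi> j = \<pi> j'"
  by (auto simp: allowed_vectors_def tiles_H1_def)

lemma allowed_vectors_H2: "allowed_vectors tiles_H2 = perm_vectors"
  by (auto simp: allowed_vectors_def tiles_H2_def)

lemma covariance_matrix_nth: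
  fixes X :: "real ^ 'm ^ 'n"
  shows "covariance_matrix X T $ j $ j' =
    (\<Sum>\<pi>\<in>allowed_vectors T. (1 / real CARD('n)) *
      (\<Sum>i\<in>UNIV. centred X $ \<pi> j i $ j * centred X $ \<pi> j' i $ j')) / card (allowed_vectors T)"
  unfolding covariance_matrix_def permute_columns_def vec_lambda_beta
  by (rule integral_pmf_of_set[OF allowed_vectors_nonempty finite_allowed_vectors])

text \<open>Reindexing rows along the common bijection makes the averaged quantity independent of
  \<open>\<pi>\<close>. This serves all entries for \<open>tiles_H1\<close> and, with
  \<open>j = j'\<close>, the diagonal for \<open>tiles_H2\<close>.\<close>

lemma covariance_matrix_nth_eq_if_common_permutation:
  fixes X :: "real ^ 'm ^ 'n"
  assumes "\<And>\<pi>. \<pi> \<in> allowed_vectors T \<Longrightarrow> \<pi> j = \<pi> j'"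
  shows "covariance_matrix X T $ j $ j' =
    (1 / real CARD('n)) * (\<Sum>i\<in>UNIV. centred X $ i $ j * centred X $ i $ j')"
proof -
  have "(\<Sum>i\<in>UNIV. centred X $ \<pi> j i $ j * centred X $ \<pi> j' i $ j') =
      (\<Sum>i\<in>UNIV. centred X $ i $ j * centred X $ i $ j')" if "\<pi> \<in> allowed_vectors T" for \<pi>
    using sum.reindex_bij_betw[OF bij_allowed_vectors[OF that, of j],
        of "\<lambda>i. centred X $ i $ j * centred X $ i $ j'"] assms[OF that]
    by simp
  then show ?thesis
    by (simp add: covariance_matrix_nth card_eq_0_iff finite_allowed_vectors
        allowed_vectors_nonempty)
qed

lemma sum_squares_centred:
  fixes X :: "real ^ 'm ^ 'n"
  assumes "unit_variance X"
  shows "(\<Sum>i\<in>UNIV. (centred X $ i $ l)\<^sup>2) = real CARD('n)"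
  using assms by (simp add: unit_variance_def divide_eq_eq)

lemma sum_centred:
  fixes X :: "real ^ 'm ^ 'n"
  shows "(\<Sum>i\<in>UNIV. centred X $ i $ l) = 0"
  by (simp add: centred_def sum_subtractf)

text \<open>Under unit variance both square roots in the Pearson denominator equal the root of
  \<open>CARD('n)\<close>, so their product is the normalising factor of the covariance.\<close>

lemma covariance_matrix_H1:
  fixes X :: "real ^ 'm ^ 'n"
  assumes "unit_variance X"
  shows "covariance_matrix X tiles_H1 = correlation_matrix X"
  by (simp add: vec_eq_iff correlation_matrix_def sum_squares_centred[OF assms]
      covariance_matrix_nth_eq_if_common_permutation[OF allowed_vectors_H1])

text \<open>
  Averaging over \<open>k\<close> after replacing \<open>\<pi> j\<close> by its composition with the transposition of
  \<open>i\<close> and \<open>k\<close> turns the factor \<open>f (\<pi> j i)\<close> into the mean of \<open>f\<close>.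
\<close>

lemma sum_perm_vectors_uncorrelated:
  fixes f g :: "'n::finite \<Rightarrow> real" and j j' :: "'m::finite"
  assumes "j \<noteq> j'" and "(\<Sum>k\<in>UNIV. f k) = 0"
  shows "(\<Sum>\<pi>\<in>perm_vectors. f (\<pi> j i) * g (\<pi> j' i)) = 0"
proof -
  let ?S = "\<lambda>k. \<Sum>\<pi>\<in>perm_vectors. f (\<pi> j k) * g (\<pi> j' i)"
  have "?S k = ?S i" for k
  proof -
    let ?h = "\<lambda>\<pi>. \<pi>(j := \<pi> j \<circ> Transposition.transpose i k)"
    have "?h \<pi> \<in> perm_vectors" if "\<pi> \<in> perm_vectors" for \<pi> :: "'m \<Rightarrow> 'n \<Rightarrow> 'n"
      using that by (auto simp: perm_vectors_def intro: bij_comp)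
    \<comment> \<open>\<open>?h\<close> is an involution, hence its own inverse witness; as
      \<open>j \<noteq> j'\<close>, it leaves \<open>\<pi> j'\<close> and so the factor of
      \<open>g\<close> untouched.\<close>
    then show ?thesis
      using assms(1)
      by (intro sum.reindex_bij_witness[of _ ?h ?h]) (auto simp: comp_assoc)
  qed
  then have "(\<Sum>k\<in>UNIV. ?S k) = (\<Sum>k\<in>(UNIV :: 'n set). ?S i)"
    by (rule sum.cong[OF refl])
  then have "real CARD('n) * ?S i = (\<Sum>k\<in>UNIV. ?S k)"
    by simp
  also have "\<dots> = (\<Sum>\<pi>\<in>perm_vectors. (\<Sum>k\<in>UNIV. f (\<pi> j k)) * g (\<pi> j' i))"
    by (subst sum.swap) (simp add: sum_distrib_right)
  also have "\<dots> = 0"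
  proof (rule sum.neutral, rule ballI)
    fix \<pi> :: "'m \<Rightarrow> 'n \<Rightarrow> 'n"
    assume "\<pi> \<in> perm_vectors"
    then have "bij (\<pi> j)"
      by (simp add: perm_vectors_def)
    then have "(\<Sum>k\<in>UNIV. f (\<pi> j k)) = 0"
      using sum.reindex_bij_betw[of "\<pi> j" UNIV UNIV f] assms(2) by simp
    then show "(\<Sum>k\<in>UNIV. f (\<pi> j k)) * g (\<pi> j' i) = 0"
      by simp
  qed
  finally show ?thesis
    by simp
qed

lemma covariance_matrix_H2:
  fixes X :: "real ^ 'm ^ 'n"
  assumes "unit_variance X"
  shows "covariance_matrix X tiles_H2 = mat 1"
proof -
  have "covariance_matrix X tiles_H2 $ j $ j = 1" for j
    using sum_squares_centred[OF assms, of j]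
    by (simp add: covariance_matrix_nth_eq_if_common_permutation power2_eq_square)
  moreover have "covariance_matrix X tiles_H2 $ j $ j' = 0" if "j \<noteq> j'" for j j'
  proof -
    have "(\<Sum>\<pi>\<in>perm_vectors. \<Sum>i\<in>UNIV. centred X $ \<pi> j i $ j * centred X $ \<pi> j' i $ j') = 0"
      \<comment> \<open>With the row \<open>i\<close> fixed outermost, each inner sum over the
        vectors vanishes because a centred column sums to 0.\<close>
      by (subst sum.swap)
        (simp add: sum_perm_vectors_uncorrelated[OF that, of "\<lambda>i. centred X $ i $ j"
            _ "\<lambda>i. centred X $ i $ j'"] sum_centred)
    then show ?thesis
      by (simp add: covariance_matrix_nth allowed_vectors_H2 flip: sum_divide_distrib)
  qed
  ultimately show ?thesis
    by (simp add: vec_eq_iff mat_def)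
qed

lemma transpose_correlation_matrix: "transpose (correlation_matrix X) = correlation_matrix X"
  by (simp add: transpose_def correlation_matrix_def vec_eq_iff mult.commute)

text \<open>The component need not be unique, so every choice is shown to be a maximiser; the
  existence part keeps this from being vacuous.\<close>

theorem theorem11:
  fixes X :: "real ^ 'm ^ 'n"
  assumes "unit_variance X"
  shows "(\<exists>v. first_principal_component (correlation_matrix X) v) \<and>
    (\<forall>v. first_principal_component (correlation_matrix X) v \<longrightarrow>
       is_arg_max (\<lambda>w. gain X w (tiles_H1, tiles_H2)) (\<lambda>w. w \<noteq> 0) v)"
proof -
  have "gain X w (tiles_H1, tiles_H2) = (w \<bullet> (correlation_matrix X *v w)) / (w \<bullet> w)" for w
    by (simp add: gain_def covariance_matrix_H1[OF assms] covariance_matrix_H2[OF assms])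
  then show ?thesis
    using first_principal_component_exists[OF transpose_correlation_matrix[of X]]
      first_principal_component_arg_max[OF transpose_correlation_matrix[of X]]
    by simp
qed

end
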